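(* Let $X$ be a nonempty set and $\sigma\colon X\times X\to\mathbb{R}_+$ a function. Let $C$ and $D$ be nonempty subsets of $X$, and let $S\colon C\to X$ and $T\colon D\to X$ be quasinonexpansive mappings with respect to $\sigma$ such that $T(D)\subset C$ and $\mathrm{F}(S)\cap\mathrm{F}(T)$ is nonempty. Then the following hold: (1) If $S$ or $T$ is strictly quasinonexpansive with respect to $\sigma$, then $\mathrm{F}(S)\cap\mathrm{F}(T)=\mathrm{F}(ST)$ and $ST\colon D\to X$ is quasinonexpansive with respect to $\sigma$. (2) Suppose that both $S$ and $T$ are strongly quasinonexpansive with respect to $\sigma$, and that $(X,\sigma)$ satisfies the following two conditions: (S) for all $x,y\in X$, $x\neq y$ if and only if $\sigma(x,y)>0$; (T) for any $u\in X$, $M>0$ and $\epsilon>0$ there exists $\eta>0$ such that $x,y,z\in\bar{B}(u,M)$, $\sigma(x,y)<\eta$ and $\sigma(y,z)<\eta$ imply $\sigma(x,z)<\epsilon$. Then $ST$ is also strongly quasinonexpansive with respect to $\sigma$.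
   Context: $\mathbb{R}_+$ is the set of nonnegative real numbers. No symmetry or triangle inequality is assumed for $\sigma$ beyond what is stated. For $z\in X$ and $M>0$, $\bar{B}(z,M)=\{x\in X:\sigma(z,x)\le M\}$. For a subset $A\subset X$ and a mapping $U\colon A\to X$, $\mathrm{F}(U)=\{z\in A: z=Uz\}$. $U$ is quasinonexpansive (with respect to $\sigma$) if $\mathrm{F}(U)\neq\emptyset$ and $\sigma(z,Ux)\le\sigma(z,x)$ for all $z\in\mathrm{F}(U)$ and $x\in A$; strictly quasinonexpansive if $\mathrm{F}(U)\neq\emptyset$ and $\sigma(z,Ux)<\sigma(z,x)$ for all $z\in\mathrm{F}(U)$ and $x\in A\setminus\mathrm{F}(U)$; strongly quasinonexpansive if $\mathrm{F}(U)\neq\emptyset$ and for any $z\in\mathrm{F}(U)$, $M>0$ and $\epsilon>0$ there exists $\delta>0$ such that $x\in A\cap\bar{B}(z,M)$ and $\sigma(z,x)-\sigma(z,Ux)<\delta$ imply $\sigma(Ux,x)<\epsilon$. $ST$ denotes the composition $x\mapsto S(Tx)$ on $D$. *)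

theory Defs
  imports Complex_Main "HOL-Library.FuncSet"
begin

text \<open>
  The space is a carrier set \<open>X\<close> with a two-place function \<open>\<sigma>\<close>, of which only the values on \<open>X\<close>
  matter. A mapping from \<open>A\<close> to \<open>X\<close> is a total function \<open>U\<close> with \<open>U \<in> A \<rightarrow> X\<close>; its values outside
  \<open>A\<close> are irrelevant, so the domain \<open>A\<close> is an explicit argument below. The conditions \<open>A \<subseteq> X\<close> and
  \<open>U \<in> A \<rightarrow> X\<close> are not part of the definitions and have to be stated separately.
\<close>

definition sigma_ball :: "'a set \<Rightarrow> ('a \<Rightarrow> 'a \<Rightarrow> real) \<Rightarrow> 'a \<Rightarrow> real \<Rightarrow> 'a set" where
  "sigma_ball X \<sigma> z M = {x \<in> X. \<sigma> z x \<le> M}"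

definition fixed_points :: "'a set \<Rightarrow> ('a \<Rightarrow> 'a) \<Rightarrow> 'a set" where
  "fixed_points A U = {z \<in> A. z = U z}"

definition quasinonexpansive :: "('a \<Rightarrow> 'a \<Rightarrow> real) \<Rightarrow> 'a set \<Rightarrow> ('a \<Rightarrow> 'a) \<Rightarrow> bool" where
  "quasinonexpansive \<sigma> A U \<longleftrightarrow>
     fixed_points A U \<noteq> {} \<and>
     (\<forall>z \<in> fixed_points A U. \<forall>x \<in> A. \<sigma> z (U x) \<le> \<sigma> z x)"

definition strictly_quasinonexpansive :: "('a \<Rightarrow> 'a \<Rightarrow> real) \<Rightarrow> 'a set \<Rightarrow> ('a \<Rightarrow> 'a) \<Rightarrow> bool" where
  "strictly_quasinonexpansive \<sigma> A U \<longleftrightarrow>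
     fixed_points A U \<noteq> {} \<and>
     (\<forall>z \<in> fixed_points A U. \<forall>x \<in> A - fixed_points A U. \<sigma> z (U x) < \<sigma> z x)"

definition strongly_quasinonexpansive ::
    "'a set \<Rightarrow> ('a \<Rightarrow> 'a \<Rightarrow> real) \<Rightarrow> 'a set \<Rightarrow> ('a \<Rightarrow> 'a) \<Rightarrow> bool" where
  "strongly_quasinonexpansive X \<sigma> A U \<longleftrightarrow>
     fixed_points A U \<noteq> {} \<and>
     (\<forall>z \<in> fixed_points A U. \<forall>M > 0. \<forall>\<epsilon> > 0. \<exists>\<delta> > 0.
        \<forall>x \<in> A \<inter> sigma_ball X \<sigma> z M. \<sigma> z x - \<sigma> z (U x) < \<delta> \<longrightarrow> \<sigma> (U x) x < \<epsilon>)"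

definition condition_S :: "'a set \<Rightarrow> ('a \<Rightarrow> 'a \<Rightarrow> real) \<Rightarrow> bool" where
  "condition_S X \<sigma> \<longleftrightarrow> (\<forall>x \<in> X. \<forall>y \<in> X. x \<noteq> y \<longleftrightarrow> \<sigma> x y > 0)"

definition condition_T :: "'a set \<Rightarrow> ('a \<Rightarrow> 'a \<Rightarrow> real) \<Rightarrow> bool" where
  "condition_T X \<sigma> \<longleftrightarrow>
     (\<forall>u \<in> X. \<forall>M > 0. \<forall>\<epsilon> > 0. \<exists>\<eta> > 0.
        \<forall>x \<in> sigma_ball X \<sigma> u M. \<forall>y \<in> sigma_ball X \<sigma> u M. \<forall>z \<in> sigma_ball X \<sigma> u M.
          \<sigma> x y < \<eta> \<and> \<sigma> y z < \<eta> \<longrightarrow> \<sigma> x z < \<epsilon>)"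

end

theory Submission
  imports Defs
begin

text \<open>
  Let \<open>p\<close> be a common fixed point. Then \<open>\<sigma> p (S (T x)) \<le> \<sigma> p (T x) \<le> \<sigma> p x\<close>, and if \<open>x\<close> is fixed by
  \<open>S \<circ> T\<close> both inequalities are equalities, so strictness of one mapping makes \<open>x\<close> a fixed point
  of both. Under condition (S) a strongly quasinonexpansive mapping is strictly quasinonexpansive;
  this identifies the fixed points of \<open>S \<circ> T\<close> in the second part as well, and condition (T) chains
  the estimates for \<open>\<sigma> (S (T x)) (T x)\<close> and \<open>\<sigma> (T x) x\<close>.
\<close>

lemma quasinonexpansiveD:
  assumes "quasinonexpansive \<sigma> A U" "z \<in> fixed_points A U" "x \<in> A"
  shows "\<sigma> z (U x) \<le> \<sigma> z x"
  using assms unfolding quasinonexpansive_def by blast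

text \<open>Contrapositive of strictness: where the value \<open>\<sigma> z x\<close> does not drop,
  the point must already be fixed.\<close>

lemma strictly_quasinonexpansiveD:
  assumes "strictly_quasinonexpansive \<sigma> A U" "z \<in> fixed_points A U" "x \<in> A"
    and "\<sigma> z x \<le> \<sigma> z (U x)"
  shows "U x = x"
  using assms unfolding strictly_quasinonexpansive_def fixed_points_def by force

lemma fixed_points_comp:
  assumes "quasinonexpansive \<sigma> C S" "quasinonexpansive \<sigma> D T" "T ` D \<subseteq> C"
    and p: "p \<in> fixed_points C S \<inter> fixed_points D T"
    and strict: "strictly_quasinonexpansive \<sigma> C S \<or> strictly_quasinonexpansive \<sigma> D T"
  shows "fixed_points D (S \<circ> T) = fixed_points C S \<inter> fixed_points D T"
proof
  show "fixed_points D (S \<circ> T) \<subseteq> fixed_points C S \<inter> fixed_points D T"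
  proof
    fix x assume "x \<in> fixed_points D (S \<circ> T)"
    then have x: "x \<in> D" "S (T x) = x" by (auto simp: fixed_points_def)
    then have "T x \<in> C" using assms(3) by blast
    \<comment> \<open>Since \<open>S (T x) = x\<close>, this is the inequality for \<open>S\<close>
      at \<open>T x\<close>.\<close>
    have "\<sigma> p x \<le> \<sigma> p (T x)"
      using quasinonexpansiveD[OF assms(1), of p "T x"] \<open>T x \<in> C\<close> p x by simp
    moreover have "\<sigma> p (T x) \<le> \<sigma> p x"
      using quasinonexpansiveD[OF assms(2), of p x] p x by simp
    ultimately have "S (T x) = T x \<or> T x = x"
      using strict strictly_quasinonexpansiveD[of \<sigma> C S p "T x"]
        strictly_quasinonexpansiveD[of \<sigma> D T p x] \<open>T x \<in> C\<close> p x by auto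
    \<comment> \<open>Either alternative gives both: \<open>S (T x) = T x\<close> combined with
      \<open>S (T x) = x\<close> yields \<open>T x = x\<close>, and \<open>T x = x\<close> turns
      \<open>S (T x) = x\<close> into \<open>S x = x\<close>.\<close>
    then show "x \<in> fixed_points C S \<inter> fixed_points D T"
      using x \<open>T x \<in> C\<close> by (auto simp: fixed_points_def)
  qed
qed (auto simp: fixed_points_def)

text \<open>By the equality of fixed point sets, every fixed point of the composition is fixed by
  both mappings, so their two inequalities can be chained.\<close>

lemma quasinonexpansive_comp:
  assumes "quasinonexpansive \<sigma> C S" "quasinonexpansive \<sigma> D T" "T ` D \<subseteq> C"
    and "fixed_points C S \<inter> fixed_points D T \<noteq> {}"
    and "fixed_points D (S \<circ> T) = fixed_points C S \<inter> fixed_points D T"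
  shows "quasinonexpansive \<sigma> D (S \<circ> T)"
  unfolding quasinonexpansive_def assms(5)
proof (intro conjI ballI)
  fix z x assume z: "z \<in> fixed_points C S \<inter> fixed_points D T" and "x \<in> D"
  then have "\<sigma> z (S (T x)) \<le> \<sigma> z (T x)"
    using assms(3) by (intro quasinonexpansiveD[OF assms(1)]) auto
  also have "\<dots> \<le> \<sigma> z x"
    using z \<open>x \<in> D\<close> by (intro quasinonexpansiveD[OF assms(2)]) auto
  finally show "\<sigma> z ((S \<circ> T) x) \<le> \<sigma> z x" by simp
qed (fact assms(4))

text \<open>Take \<epsilon> to be \<open>\<sigma> (U x) x\<close>, which is positive by (S) when
  \<open>x\<close> is not fixed. Without a strict decrease the difference
  \<open>\<sigma> z x - \<sigma> z (U x)\<close> would be at most 0, hence below any \<delta>,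
  giving \<open>\<sigma> (U x) x < \<sigma> (U x) x\<close>.\<close>

lemma strongly_imp_strictly_quasinonexpansive:
  assumes "condition_S X \<sigma>" "A \<subseteq> X" "U \<in> A \<rightarrow> X"
    and nonneg: "\<And>x y. x \<in> X \<Longrightarrow> y \<in> X \<Longrightarrow> 0 \<le> \<sigma> x y"
    and U: "strongly_quasinonexpansive X \<sigma> A U"
  shows "strictly_quasinonexpansive \<sigma> A U"
  unfolding strictly_quasinonexpansive_def
proof (intro conjI ballI)
  show "fixed_points A U \<noteq> {}"
    using U by (simp add: strongly_quasinonexpansive_def)
next
  fix z x assume z: "z \<in> fixed_points A U" and x: "x \<in> A - fixed_points A U"
  then have "U x \<noteq> x" "x \<in> X" "U x \<in> X" "z \<in> X"
    using assms(2,3) by (auto simp: fixed_points_def)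
  then have "0 < \<sigma> (U x) x"
    using assms(1) by (auto simp: condition_S_def)
  \<comment> \<open>The radius \<open>\<sigma> z x + 1\<close> is positive and its ball around
    \<open>z\<close> contains \<open>x\<close>.\<close>
  moreover have "0 < \<sigma> z x + 1"
    using nonneg[OF \<open>z \<in> X\<close> \<open>x \<in> X\<close>] by simp
  ultimately obtain \<delta> where "\<delta> > 0" and
    \<delta>: "\<And>y. y \<in> A \<inter> sigma_ball X \<sigma> z (\<sigma> z x + 1) \<Longrightarrow> \<sigma> z y - \<sigma> z (U y) < \<delta>
      \<Longrightarrow> \<sigma> (U y) y < \<sigma> (U x) x"
    using U z unfolding strongly_quasinonexpansive_def by meson
  have "x \<in> A \<inter> sigma_ball X \<sigma> z (\<sigma> z x + 1)"
    using x \<open>x \<in> X\<close> by (simp add: sigma_ball_def)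
  then show "\<sigma> z (U x) < \<sigma> z x"
    using \<delta>[of x] \<open>\<delta> > 0\<close> by force
qed

lemma strongly_quasinonexpansive_comp:
  assumes "C \<subseteq> X" "D \<subseteq> X" "S \<in> C \<rightarrow> X" "T ` D \<subseteq> C"
    and qS: "quasinonexpansive \<sigma> C S" and qT: "quasinonexpansive \<sigma> D T"
    and sS: "strongly_quasinonexpansive X \<sigma> C S"
    and sT: "strongly_quasinonexpansive X \<sigma> D T"
    and "condition_T X \<sigma>"
    and "fixed_points C S \<inter> fixed_points D T \<noteq> {}"
    and fixed: "fixed_points D (S \<circ> T) = fixed_points C S \<inter> fixed_points D T"
  shows "strongly_quasinonexpansive X \<sigma> D (S \<circ> T)"
  unfolding strongly_quasinonexpansive_def fixed
proof (intro conjI ballI allI impI)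
  fix z and M \<epsilon> :: real
  assume z: "z \<in> fixed_points C S \<inter> fixed_points D T" and M: "M > 0" and \<epsilon>: "\<epsilon> > 0"
  let ?B = "sigma_ball X \<sigma> z M"
  have "z \<in> X" using z assms(2) by (auto simp: fixed_points_def)
  \<comment> \<open>The \<eta> that (T) provides for \<epsilon> serves as the tolerance for both
    \<open>S\<close> and \<open>T\<close>.\<close>
  then obtain \<eta> where "\<eta> > 0" and \<eta>:
    "\<And>x y w. x \<in> ?B \<Longrightarrow> y \<in> ?B \<Longrightarrow> w \<in> ?B \<Longrightarrow> \<sigma> x y < \<eta> \<Longrightarrow> \<sigma> y w < \<eta> \<Longrightarrow> \<sigma> x w < \<epsilon>"
    using assms(9) M \<epsilon> unfolding condition_T_def by meson
  obtain \<delta>S where "\<delta>S > 0" and \<delta>S: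
    "\<And>x. x \<in> C \<inter> ?B \<Longrightarrow> \<sigma> z x - \<sigma> z (S x) < \<delta>S \<Longrightarrow> \<sigma> (S x) x < \<eta>"
    using sS z M \<open>\<eta> > 0\<close> unfolding strongly_quasinonexpansive_def by (meson IntD1)
  obtain \<delta>T where "\<delta>T > 0" and \<delta>T:
    "\<And>x. x \<in> D \<inter> ?B \<Longrightarrow> \<sigma> z x - \<sigma> z (T x) < \<delta>T \<Longrightarrow> \<sigma> (T x) x < \<eta>"
    using sT z M \<open>\<eta> > 0\<close> unfolding strongly_quasinonexpansive_def by (meson IntD2)
  show "\<exists>\<delta>>0. \<forall>x\<in>D \<inter> ?B. \<sigma> z x - \<sigma> z ((S \<circ> T) x) < \<delta> \<longrightarrow> \<sigma> ((S \<circ> T) x) x < \<epsilon>"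
  proof (intro exI[of _ "min \<delta>S \<delta>T"] conjI ballI impI)
    show "0 < min \<delta>S \<delta>T" using \<open>\<delta>S > 0\<close> \<open>\<delta>T > 0\<close> by simp
  next
    fix x assume x: "x \<in> D \<inter> ?B" and less: "\<sigma> z x - \<sigma> z ((S \<circ> T) x) < min \<delta>S \<delta>T"
    have "T x \<in> C" using x assms(4) by blast
    then have "T x \<in> X" "S (T x) \<in> X" using assms(1,3) by auto
    have leT: "\<sigma> z (T x) \<le> \<sigma> z x"
      using z x by (intro quasinonexpansiveD[OF qT]) auto
    have leS: "\<sigma> z (S (T x)) \<le> \<sigma> z (T x)"
      using z \<open>T x \<in> C\<close> by (intro quasinonexpansiveD[OF qS]) auto
    \<comment> \<open>Values of \<open>\<sigma> z\<close> do not grow along \<open>x\<close>,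
      \<open>T x\<close>, \<open>S (T x)\<close>, so all three points lie in the ball on which (T)
      and the choice of \<open>\<delta>S\<close> apply.\<close>
    have Tx: "T x \<in> ?B" and STx: "S (T x) \<in> ?B"
      using x leT leS \<open>T x \<in> X\<close> \<open>S (T x) \<in> X\<close> by (auto simp: sigma_ball_def)
    \<comment> \<open>The total drop from \<open>x\<close> to \<open>S (T x)\<close> is the sum of
      the nonnegative drops under \<open>T\<close> and \<open>S\<close>, so each of them is below
      \<open>min \<delta>S \<delta>T\<close>.\<close>
    have "\<sigma> (S (T x)) (T x) < \<eta>"
      using Tx \<open>T x \<in> C\<close> leT less by (intro \<delta>S) auto
    moreover have "\<sigma> (T x) x < \<eta>"
      using x leS less by (intro \<delta>T) auto
    ultimately show "\<sigma> ((S \<circ> T) x) x < \<epsilon>"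
      using \<eta>[OF STx Tx, of x] x by simp
  qed
qed (fact assms(10))

theorem theorem4p9:
  fixes X C D :: "'a set"
    and \<sigma> :: "'a \<Rightarrow> 'a \<Rightarrow> real"
    and S T :: "'a \<Rightarrow> 'a"
  assumes "X \<noteq> {}"
    and "\<And>x y. x \<in> X \<Longrightarrow> y \<in> X \<Longrightarrow> 0 \<le> \<sigma> x y"
    and "C \<subseteq> X" and "C \<noteq> {}"
    and "D \<subseteq> X" and "D \<noteq> {}"
    and "S \<in> C \<rightarrow> X" and "T \<in> D \<rightarrow> X"
    and "quasinonexpansive \<sigma> C S"
    and "quasinonexpansive \<sigma> D T"
    and "T ` D \<subseteq> C"
    and "fixed_points C S \<inter> fixed_points D T \<noteq> {}"
  shows "(strictly_quasinonexpansive \<sigma> C S \<or> strictly_quasinonexpansive \<sigma> D T \<longrightarrow>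
            fixed_points C S \<inter> fixed_points D T = fixed_points D (S \<circ> T) \<and>
            S \<circ> T \<in> D \<rightarrow> X \<and> quasinonexpansive \<sigma> D (S \<circ> T)) \<and>
         (strongly_quasinonexpansive X \<sigma> C S \<and> strongly_quasinonexpansive X \<sigma> D T \<and>
          condition_S X \<sigma> \<and> condition_T X \<sigma> \<longrightarrow>
            S \<circ> T \<in> D \<rightarrow> X \<and> strongly_quasinonexpansive X \<sigma> D (S \<circ> T))"
proof -
  obtain p where p: "p \<in> fixed_points C S \<inter> fixed_points D T"
    using assms(12) by blast
  note fixed = fixed_points_comp[OF assms(9-11) p]
  have maps: "S \<circ> T \<in> D \<rightarrow> X"
    using assms(7,11) by fastforce
  show ?thesis
  proof (intro conjI impI; (elim conjE)?)
    assume "strictly_quasinonexpansive \<sigma> C S \<or> strictly_quasinonexpansive \<sigma> D T"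
    note eq = fixed[OF this]
    show "fixed_points C S \<inter> fixed_points D T = fixed_points D (S \<circ> T)"
      using eq by simp
    show "quasinonexpansive \<sigma> D (S \<circ> T)"
      using assms(9-12) eq by (rule quasinonexpansive_comp)
  next
    assume strong: "strongly_quasinonexpansive X \<sigma> C S" "strongly_quasinonexpansive X \<sigma> D T"
      and cond: "condition_S X \<sigma>" "condition_T X \<sigma>"
    \<comment> \<open>Strictness of one of the two mappings is enough to identify the fixed points
      of \<open>S \<circ> T\<close>.\<close>
    have "strictly_quasinonexpansive \<sigma> C S"
      using cond(1) assms(3,7,2) strong(1) by (rule strongly_imp_strictly_quasinonexpansive)
    then have "fixed_points D (S \<circ> T) = fixed_points C S \<inter> fixed_points D T"
      using fixed by blast
    then show "strongly_quasinonexpansive X \<sigma> D (S \<circ> T)"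
      by (rule strongly_quasinonexpansive_comp[OF assms(3,5,7,11,9,10) strong cond(2) assms(12)])
  qed (rule maps)+
qed

end
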